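(* Let $f=(f_1,f_2)$ and $f^{v}=(f_1^{v},f_2^{v})$ be the vector-valued fractal interpolation functions corresponding to the generalised data sets $V^{*}=\{(t_j,u_j,v_j):j=0,1,\ldots,N\}$ and $V_3^{*}=\{(t_j,u_j,v_j'):j=0,1,\ldots,N\}$, respectively, built with the same $L_j,\alpha_j,\beta_j,\gamma_j,\delta_j,s_j,r_j$ and with the Lipschitz functions $(p_j,q_j)$ for $V^*$ and $(p_j^v,q_j^v)$ for $V_3^*$, as described in the context. Put $$\zeta=\max_{1\le j\le N}\max_{t\in I}\{|\alpha_j(t)|,|\beta_j(t)|\},\qquad \eta=\max_{1\le j\le N}\max_{t\in I}\{|\gamma_j(t)|,|\delta_j(t)|\},$$ and suppose $\zeta+\eta<1$. Then $$\|f_1-f_1^{v}\|_{\infty}<\frac{\zeta}{1-\zeta-\eta}\max_{1\le j\le N}\{l_{q_j}+l_{q_j^{v}}\}+\frac{1+\zeta-\eta+\zeta\eta}{1-\zeta-\eta}\max_{0\le j\le N}|v_j-v_j'|+\frac{1-\eta}{1-\zeta-\eta}\max_{1\le j\le N}\{l_{p_j}+l_{p_j^{v}}\}.$$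
   Context: Let $I=[0,1]$, $N\ge 2$, and $0=t_0<t_1<\cdots<t_N=1$. Let $I_j=[t_{j-1},t_j]$ and let $L_j:I\to I_j$ be $L_j(t)=\frac{t_j-t_{j-1}}{t_N-t_0}(t-t_0)+t_{j-1}$ for $j=1,\ldots,N$. A map $T$ of a metric space $(X,d)$ into itself is an Edelstein contraction if $d(Tx,Ty)<d(x,y)$ for all $x\ne y$. Let $\alpha_j,\beta_j,\gamma_j,\delta_j:I\to\mathbb{R}$ be Lipschitz with $\|\alpha_j\|_\infty+\|\gamma_j\|_\infty\le 1$ and $\|\beta_j\|_\infty+\|\delta_j\|_\infty\le 1$, and let $s_j,r_j:\mathbb{R}\to\mathbb{R}$ be Edelstein contractions ($j=1,\ldots,N$). Generalised data set $V^*=\{(t_j,u_j,v_j)\}\subset I\times\mathbb{R}^2$: let $p_j,q_j:I\to\mathbb{R}$ be Lipschitz functions such that $$F_j(t,u,v)=\big(\alpha_j(t)s_j(u)+\beta_j(t)r_j(v)+p_j(t),\ \gamma_j(t)s_j(u)+\delta_j(t)r_j(v)+q_j(t)\big)$$ satisfies $F_j(t_0,u_0,v_0)=(u_{j-1},v_{j-1})$ and $F_j(t_N,u_N,v_N)=(u_j,v_j)$ for $j=1,\ldots,N$. Let $K\subset\mathbb{R}^2$ be a compact set with $F_j(I\times K)\subset K$ for all $j$; the associated iterated function system is $\{I\times K,\ \omega_j=(L_j,F_j):j=1,\ldots,N\}$. The vector-valued fractal interpolation function $f=(f_1,f_2)$ corresponding to $V^*$ is the unique continuous $f:I\to\mathbb{R}^2$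 with $f(t_j)=(u_j,v_j)$ for $j=0,\ldots,N$ and $f(L_j(t))=F_j(t,f(t))$ for all $t\in I$, $j=1,\ldots,N$; its first component $f_1$ is called the Edelstein hidden-variable fractal interpolation function. Generalised data set $V_3^*=\{(t_j,u_j,v_j')\}$: the function $f^v=(f_1^v,f_2^v)$ is defined in the same way, with the same $L_j,\alpha_j,\beta_j,\gamma_j,\delta_j,s_j,r_j$, but with $p_j,q_j$ replaced by Lipschitz functions $p_j^v,q_j^v:I\to\mathbb{R}$ such that the resulting maps $F_j^v$ satisfy $F_j^v(t_0,u_0,v_0')=(u_{j-1},v_{j-1}')$ and $F_j^v(t_N,u_N,v_N')=(u_j,v_j')$. For a Lipschitz function $g:I\to\mathbb{R}$, $l_g$ denotes a Lipschitz constant of $g$, and $\|g\|_\infty=\sup_{t\in I}|g(t)|$.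
   Formalization: The formal theorem adds the assumption that the right-hand side is not zero, i.e. max|v_j-v_j'|, max(l_p+l_{p^v}) and ζ·max(l_q+l_{q^v}) do not all vanish; otherwise the strict inequality would read 0<0 (e.g. all data and functions zero). *)

theory Defs
  imports "HOL-Analysis.Analysis"
begin

definition edelstein_contraction :: "('a::metric_space \<Rightarrow> 'a) \<Rightarrow> bool" where
  "edelstein_contraction T \<longleftrightarrow> (\<forall>x y. x \<noteq> y \<longrightarrow> dist (T x) (T y) < dist x y)"

definition lipschitz_I :: "(real \<Rightarrow> real) \<Rightarrow> bool" where
  "lipschitz_I g \<longleftrightarrow> (\<exists>C. C-lipschitz_on {0..1} g)"

text \<open>Only meaningful for functions bounded on the unit interval; it is applied to functions
  that are continuous there.\<close>

definition sup_norm_I :: "(real \<Rightarrow> real) \<Rightarrow> real" where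
  "sup_norm_I g = (SUP x\<in>{0..1}. \<bar>g x\<bar>)"

text \<open>The inner maximum over the unit interval is written as a supremum; it is attained when the
  functions are continuous.\<close>

definition coeff_max :: "nat \<Rightarrow> (nat \<Rightarrow> real \<Rightarrow> real) \<Rightarrow> (nat \<Rightarrow> real \<Rightarrow> real) \<Rightarrow> real" where
  "coeff_max N a b = (MAX j\<in>{1..N}. SUP x\<in>{0..1}. max \<bar>a j x\<bar> \<bar>b j x\<bar>)"

definition L_map :: "nat \<Rightarrow> (nat \<Rightarrow> real) \<Rightarrow> nat \<Rightarrow> real \<Rightarrow> real" where
  "L_map N t j x = (t j - t (j - 1)) / (t N - t 0) * (x - t 0) + t (j - 1)"

definition F_map ::
  "(nat \<Rightarrow> real \<Rightarrow> real) \<Rightarrow> (nat \<Rightarrow> real \<Rightarrow> real) \<Rightarrow> (nat \<Rightarrow> real \<Rightarrow> real) \<Rightarrow> (nat \<Rightarrow> real \<Rightarrow> real) \<Rightarrow>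
   (nat \<Rightarrow> real \<Rightarrow> real) \<Rightarrow> (nat \<Rightarrow> real \<Rightarrow> real) \<Rightarrow> (nat \<Rightarrow> real \<Rightarrow> real) \<Rightarrow> (nat \<Rightarrow> real \<Rightarrow> real) \<Rightarrow>
   nat \<Rightarrow> real \<Rightarrow> real \<times> real \<Rightarrow> real \<times> real" where
  "F_map \<alpha> \<beta> \<gamma> \<delta> s r p q j x z =
     (\<alpha> j x * s j (fst z) + \<beta> j x * r j (snd z) + p j x,
      \<gamma> j x * s j (fst z) + \<delta> j x * r j (snd z) + q j x)"

text \<open>The indexed families are total functions on the natural numbers; only the indices
  \<open>1, \<dots>, N\<close> (or \<open>0, \<dots>, N\<close> for nodes and data) are constrained, and the functions of the
  interval variable only matter on the unit interval.\<close>

locale edelstein_coefficients =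
  fixes N :: nat
    and t :: "nat \<Rightarrow> real"
    and \<alpha> \<beta> \<gamma> \<delta> :: "nat \<Rightarrow> real \<Rightarrow> real"
    and s r :: "nat \<Rightarrow> real \<Rightarrow> real"
  assumes N_ge_2: "2 \<le> N"
    and t_first: "t 0 = 0"
    and t_last: "t N = 1"
    and t_increasing: "\<And>j. j \<in> {1..N} \<Longrightarrow> t (j - 1) < t j"
    and lipschitz_alpha: "\<And>j. j \<in> {1..N} \<Longrightarrow> lipschitz_I (\<alpha> j)"
    and lipschitz_beta: "\<And>j. j \<in> {1..N} \<Longrightarrow> lipschitz_I (\<beta> j)"
    and lipschitz_gamma: "\<And>j. j \<in> {1..N} \<Longrightarrow> lipschitz_I (\<gamma> j)"
    and lipschitz_delta: "\<And>j. j \<in> {1..N} \<Longrightarrow> lipschitz_I (\<delta> j)"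
    and alpha_gamma: "\<And>j. j \<in> {1..N} \<Longrightarrow> sup_norm_I (\<alpha> j) + sup_norm_I (\<gamma> j) \<le> 1"
    and beta_delta: "\<And>j. j \<in> {1..N} \<Longrightarrow> sup_norm_I (\<beta> j) + sup_norm_I (\<delta> j) \<le> 1"
    and edelstein_s: "\<And>j. j \<in> {1..N} \<Longrightarrow> edelstein_contraction (s j)"
    and edelstein_r: "\<And>j. j \<in> {1..N} \<Longrightarrow> edelstein_contraction (r j)"

locale edelstein_ifs = edelstein_coefficients N t \<alpha> \<beta> \<gamma> \<delta> s r
  for N :: nat
    and t :: "nat \<Rightarrow> real"
    and \<alpha> \<beta> \<gamma> \<delta> :: "nat \<Rightarrow> real \<Rightarrow> real"
    and s r :: "nat \<Rightarrow> real \<Rightarrow> real" +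
  fixes u v :: "nat \<Rightarrow> real"
    and p q :: "nat \<Rightarrow> real \<Rightarrow> real"
    and K :: "(real \<times> real) set"
  assumes lipschitz_p: "\<And>j. j \<in> {1..N} \<Longrightarrow> lipschitz_I (p j)"
    and lipschitz_q: "\<And>j. j \<in> {1..N} \<Longrightarrow> lipschitz_I (q j)"
    and F_first: "\<And>j. j \<in> {1..N} \<Longrightarrow>
      F_map \<alpha> \<beta> \<gamma> \<delta> s r p q j (t 0) (u 0, v 0) = (u (j - 1), v (j - 1))"
    and F_last: "\<And>j. j \<in> {1..N} \<Longrightarrow>
      F_map \<alpha> \<beta> \<gamma> \<delta> s r p q j (t N) (u N, v N) = (u j, v j)"
    and K_compact: "compact K"
    and K_invariant: "\<And>j x z. j \<in> {1..N} \<Longrightarrow> x \<in> {0..1} \<Longrightarrow> z \<in> K \<Longrightarrow>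
      F_map \<alpha> \<beta> \<gamma> \<delta> s r p q j x z \<in> K"

text \<open>The fractal interpolation function is determined on the unit interval by this predicate;
  its values elsewhere are irrelevant.\<close>

definition vector_fif ::
  "nat \<Rightarrow> (nat \<Rightarrow> real) \<Rightarrow>
   (nat \<Rightarrow> real \<Rightarrow> real) \<Rightarrow> (nat \<Rightarrow> real \<Rightarrow> real) \<Rightarrow> (nat \<Rightarrow> real \<Rightarrow> real) \<Rightarrow> (nat \<Rightarrow> real \<Rightarrow> real) \<Rightarrow>
   (nat \<Rightarrow> real \<Rightarrow> real) \<Rightarrow> (nat \<Rightarrow> real \<Rightarrow> real) \<Rightarrow> (nat \<Rightarrow> real) \<Rightarrow> (nat \<Rightarrow> real) \<Rightarrow>
   (nat \<Rightarrow> real \<Rightarrow> real) \<Rightarrow> (nat \<Rightarrow> real \<Rightarrow> real) \<Rightarrow> (real \<Rightarrow> real \<times> real) \<Rightarrow> bool" where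
  "vector_fif N t \<alpha> \<beta> \<gamma> \<delta> s r u v p q f \<longleftrightarrow>
     continuous_on {0..1} f \<and>
     (\<forall>j\<in>{0..N}. f (t j) = (u j, v j)) \<and>
     (\<forall>j\<in>{1..N}. \<forall>x\<in>{0..1}. f (L_map N t j x) = F_map \<alpha> \<beta> \<gamma> \<delta> s r p q j x (f x))"

end

theory Submission
  imports Defs
begin

text \<open>
  The self-referential equations bound the sup norms \<open>A\<close>, \<open>B\<close> of the two components of \<open>f - fv\<close> by
  \<open>A \<le> \<zeta> (A + B) + \<parallel>p - pv\<parallel>\<close> and \<open>B \<le> \<eta> (A + B) + \<parallel>q - qv\<parallel>\<close>, and \<open>B\<close> is eliminated.
  The join-up conditions control \<open>p - pv\<close> and \<open>q - qv\<close> at both end points by \<open>\<zeta> M\<close> and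
  \<open>(1 + \<eta>) M\<close>, where \<open>M = max |v j - v' j|\<close>. Starting from the nearer end point costs only half
  of the Lipschitz constants, which together with \<open>2 \<zeta> < 1 + \<zeta> - \<eta> + \<zeta> \<eta>\<close> makes the final
  inequality strict.
\<close>

lemma edelstein_contraction_dist_le:
  assumes "edelstein_contraction T"
  shows "dist (T x) (T y) \<le> dist x y"
  using assms unfolding edelstein_contraction_def by (cases "x = y") (auto intro: less_imp_le)

text \<open>Edelstein contractions are 1-Lipschitz, and one common bound \<open>c\<close> for both
  coefficients lets the two increments be added under a single factor. It serves twice: at the end
  points, where only the second argument changes, and along the two graphs, where both do.\<close>

lemma edelstein_combination_bound:
  fixes S R :: "real \<Rightarrow> real"
  assumes "edelstein_contraction S" "edelstein_contraction R" "\<bar>a\<bar> \<le> c" "\<bar>b\<bar> \<le> c"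
  shows "\<bar>(a * S x + b * R y) - (a * S x' + b * R y')\<bar> \<le> c * (\<bar>x - x'\<bar> + \<bar>y - y'\<bar>)"
proof -
  have "\<bar>a * (S x - S x')\<bar> \<le> c * \<bar>x - x'\<bar>"
    unfolding abs_mult using assms edelstein_contraction_dist_le[of S x x']
    by (intro mult_mono) (auto simp: dist_real_def)
  moreover have "\<bar>b * (R y - R y')\<bar> \<le> c * \<bar>y - y'\<bar>"
    unfolding abs_mult using assms edelstein_contraction_dist_le[of R y y']
    by (intro mult_mono) (auto simp: dist_real_def)
  ultimately show ?thesis by (simp add: algebra_simps)
qed

lemma continuous_on_abs_le:
  fixes g :: "real \<Rightarrow> real"
  assumes "continuous_on {0..1} g"
  obtains B where "\<And>x. x \<in> {0..1} \<Longrightarrow> \<bar>g x\<bar> \<le> B"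
proof -
  have "bounded (g ` {0..1})"
    using assms compact_continuous_image compact_imp_bounded compact_Icc by blast
  then obtain B where "\<forall>x\<in>{0..1}. \<bar>g x\<bar> \<le> B" unfolding bounded_iff by auto
  then show ?thesis by (intro that) auto
qed

lemma lipschitz_I_continuous_on: "lipschitz_I g \<Longrightarrow> continuous_on {0..1} g"
  unfolding lipschitz_I_def using lipschitz_on_continuous_on by blast

text \<open>Continuity on the compact interval supplies the upper bound without which a real-valued
  \<open>SUP\<close> need not dominate the values.\<close>

lemma abs_le_sup_norm_I:
  assumes "continuous_on {0..1} g" "x \<in> {0..1}"
  shows "\<bar>g x\<bar> \<le> sup_norm_I g"
proof -
  obtain B where "\<And>x. x \<in> {0..1} \<Longrightarrow> \<bar>g x\<bar> \<le> B"
    using continuous_on_abs_le[OF assms(1)] by blast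
  then show ?thesis
    unfolding sup_norm_I_def using assms(2) by (intro cSUP_upper bdd_aboveI2)
qed

lemma coeff_max_upper:
  assumes "lipschitz_I (a j)" "lipschitz_I (b j)" "j \<in> {1..N}" "x \<in> {0..1}"
  shows "\<bar>a j x\<bar> \<le> coeff_max N a b" "\<bar>b j x\<bar> \<le> coeff_max N a b"
proof -
  obtain A where A: "\<And>x. x \<in> {0..1} \<Longrightarrow> \<bar>a j x\<bar> \<le> A"
    using continuous_on_abs_le lipschitz_I_continuous_on[OF assms(1)] by blast
  obtain B where B: "\<And>x. x \<in> {0..1} \<Longrightarrow> \<bar>b j x\<bar> \<le> B"
    using continuous_on_abs_le lipschitz_I_continuous_on[OF assms(2)] by blast
  have "max \<bar>a j x\<bar> \<bar>b j x\<bar> \<le> (SUP x\<in>{0..1}. max \<bar>a j x\<bar> \<bar>b j x\<bar>)"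
    using assms(4)
  proof (intro cSUP_upper bdd_aboveI2)
    show "max \<bar>a j y\<bar> \<bar>b j y\<bar> \<le> max A B" if "y \<in> {0..1}" for y
      using A[OF that] B[OF that] by linarith
  qed
  also have "\<dots> \<le> coeff_max N a b"
    unfolding coeff_max_def using assms(3) by (intro Max_ge) auto
  finally show "\<bar>a j x\<bar> \<le> coeff_max N a b" "\<bar>b j x\<bar> \<le> coeff_max N a b" by auto
qed

lemma lipschitz_on_unit_interval_bound:
  fixes g :: "real \<Rightarrow> real"
  assumes "l-lipschitz_on {0..1} g" "\<bar>g 0\<bar> \<le> c" "\<bar>g 1\<bar> \<le> c" "x \<in> {0..1}"
  shows "\<bar>g x\<bar> \<le> c + l / 2"
proof -
  have l: "0 \<le> l" and d: "\<And>y. y \<in> {0..1} \<Longrightarrow> \<bar>g x - g y\<bar> \<le> l * \<bar>x - y\<bar>"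
    using assms lipschitz_on_nonneg lipschitz_onD[OF assms(1)] by (auto simp: dist_real_def)
  show ?thesis
  proof (cases "x \<le> 1 / 2")
    case True
    then have "l * \<bar>x - 0\<bar> \<le> l * (1 / 2)" using l assms(4) by (intro mult_left_mono) auto
    then show ?thesis using d[of 0] assms(2) by auto
  next
    case False
    then have "l * \<bar>x - 1\<bar> \<le> l * (1 / 2)" using l assms(4) by (intro mult_left_mono) auto
    then show ?thesis using d[of 1] assms(3) by auto
  qed
qed

context edelstein_coefficients
begin

lemma L_map_covers:
  assumes y: "y \<in> {0..1}"
  obtains j x where "j \<in> {1..N}" "x \<in> {0..1}" "L_map N t j x = y"
proof -
  \<comment> \<open>The leftmost piece containing \<open>y\<close>: minimality of \<open>j\<close>
    puts \<open>y\<close> to the right of the previous node.\<close>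
  define j where "j = (LEAST j. 1 \<le> j \<and> y \<le> t j)"
  have ex: "1 \<le> N \<and> y \<le> t N" using y N_ge_2 t_last by auto
  have j: "1 \<le> j" "y \<le> t j" using LeastI[of "\<lambda>j. 1 \<le> j \<and> y \<le> t j", OF ex] by (auto simp: j_def)
  have jN: "j \<le> N" unfolding j_def by (rule Least_le) (rule ex)
  \<comment> \<open>Minimality ranges over positive indices only, so for \<open>j = 1\<close> the
    bound comes from \<open>t 0 = 0\<close> instead.\<close>
  have lower: "t (j - 1) \<le> y"
  proof (cases "j = 1")
    case True
    then show ?thesis using y t_first by auto
  next
    case False
    then have "\<not> (1 \<le> j - 1 \<and> y \<le> t (j - 1))"
      unfolding j_def using j(1) by (intro not_less_Least) (auto simp: j_def)
    then show ?thesis using False j by auto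
  qed
  have lt: "t (j - 1) < t j" using t_increasing j jN by auto
  show ?thesis
  proof (rule that)
    show "j \<in> {1..N}" using j jN by auto
    show "(y - t (j - 1)) / (t j - t (j - 1)) \<in> {0..1}" using lower lt j by auto
    show "L_map N t j ((y - t (j - 1)) / (t j - t (j - 1))) = y"
      unfolding L_map_def using lt by (simp add: t_first t_last)
  qed
qed

text \<open>The self-referential equation describes a function only at points
  \<open>L_map N t j x\<close>. As these exhaust the interval, bounds there control the whole sup
  norm.\<close>

lemma sup_norm_I_le_by_pieces:
  assumes "\<And>j x. j \<in> {1..N} \<Longrightarrow> x \<in> {0..1} \<Longrightarrow> \<bar>g (L_map N t j x)\<bar> \<le> c"
  shows "sup_norm_I g \<le> c"
  unfolding sup_norm_I_def
proof (rule cSUP_least)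
  show "\<bar>g y\<bar> \<le> c" if "y \<in> {0..1}" for y
    using L_map_covers[OF that] assms by metis
qed auto

end

text \<open>The coefficients of the M and P terms below are positive, so
  \<open>nondegenerate\<close> says that the right-hand side is not 0. If it were 0, the strict
  inequality would fail, since the left-hand side is nonnegative.\<close>

theorem theorem7:
  fixes N :: nat
    and t u v v' :: "nat \<Rightarrow> real"
    and \<alpha> \<beta> \<gamma> \<delta> s r p q pv qv :: "nat \<Rightarrow> real \<Rightarrow> real"
    and K Kv :: "(real \<times> real) set"
    and f fv :: "real \<Rightarrow> real \<times> real"
    and lp lq lpv lqv :: "nat \<Rightarrow> real"
    and \<zeta> \<eta> :: real
  assumes ifs: "edelstein_ifs N t \<alpha> \<beta> \<gamma> \<delta> s r u v p q K"
    and ifs_v: "edelstein_ifs N t \<alpha> \<beta> \<gamma> \<delta> s r u v' pv qv Kv"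
    and f: "vector_fif N t \<alpha> \<beta> \<gamma> \<delta> s r u v p q f"
    and fv: "vector_fif N t \<alpha> \<beta> \<gamma> \<delta> s r u v' pv qv fv"
    and lp: "\<And>j. j \<in> {1..N} \<Longrightarrow> (lp j)-lipschitz_on {0..1} (p j)"
    and lq: "\<And>j. j \<in> {1..N} \<Longrightarrow> (lq j)-lipschitz_on {0..1} (q j)"
    and lpv: "\<And>j. j \<in> {1..N} \<Longrightarrow> (lpv j)-lipschitz_on {0..1} (pv j)"
    and lqv: "\<And>j. j \<in> {1..N} \<Longrightarrow> (lqv j)-lipschitz_on {0..1} (qv j)"
    and zeta: "\<zeta> = coeff_max N \<alpha> \<beta>"
    and eta: "\<eta> = coeff_max N \<gamma> \<delta>"
    and zeta_eta: "\<zeta> + \<eta> < 1"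
    and nondegenerate:
      "0 < (MAX j\<in>{0..N}. \<bar>v j - v' j\<bar>) \<or>
       0 < (MAX j\<in>{1..N}. lp j + lpv j) \<or>
       0 < \<zeta> * (MAX j\<in>{1..N}. lq j + lqv j)"
  shows "sup_norm_I (\<lambda>x. fst (f x) - fst (fv x)) <
      \<zeta> / (1 - \<zeta> - \<eta>) * (MAX j\<in>{1..N}. lq j + lqv j)
      + (1 + \<zeta> - \<eta> + \<zeta> * \<eta>) / (1 - \<zeta> - \<eta>) * (MAX j\<in>{0..N}. \<bar>v j - v' j\<bar>)
      + (1 - \<eta>) / (1 - \<zeta> - \<eta>) * (MAX j\<in>{1..N}. lp j + lpv j)"
proof -
  interpret V: edelstein_ifs N t \<alpha> \<beta> \<gamma> \<delta> s r u v p q K by (rule ifs)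
  interpret V': edelstein_ifs N t \<alpha> \<beta> \<gamma> \<delta> s r u v' pv qv Kv by (rule ifs_v)
  define M where "M = (MAX j\<in>{0..N}. \<bar>v j - v' j\<bar>)"
  define P where "P = (MAX j\<in>{1..N}. lp j + lpv j)"
  define Q where "Q = (MAX j\<in>{1..N}. lq j + lqv j)"
  define A where "A = sup_norm_I (\<lambda>x. fst (f x) - fst (fv x))"
  define B where "B = sup_norm_I (\<lambda>x. snd (f x) - snd (fv x))"
  have M: "\<bar>v j - v' j\<bar> \<le> M" if "j \<in> {0..N}" for j
    unfolding M_def using that by (intro Max_ge) auto
  have P: "lp j + lpv j \<le> P" and Q: "lq j + lqv j \<le> Q" if "j \<in> {1..N}" for j
    unfolding P_def Q_def using that by (auto intro!: Max_ge)
  have one: "1 \<in> {1..N}" using V.N_ge_2 by auto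
  have M0: "0 \<le> M" using M[of 0] by auto
  have P0: "0 \<le> P"
    using P[OF one] lipschitz_on_nonneg[OF lp[OF one]] lipschitz_on_nonneg[OF lpv[OF one]] by linarith
  have Q0: "0 \<le> Q"
    using Q[OF one] lipschitz_on_nonneg[OF lq[OF one]] lipschitz_on_nonneg[OF lqv[OF one]] by linarith
  have \<zeta>: "\<bar>\<alpha> j x\<bar> \<le> \<zeta>" "\<bar>\<beta> j x\<bar> \<le> \<zeta>" and \<eta>: "\<bar>\<gamma> j x\<bar> \<le> \<eta>" "\<bar>\<delta> j x\<bar> \<le> \<eta>"
    if "j \<in> {1..N}" "x \<in> {0..1}" for j x
    unfolding zeta eta
    using that V.lipschitz_alpha V.lipschitz_beta V.lipschitz_gamma V.lipschitz_delta
    by (auto intro!: coeff_max_upper)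
  have \<zeta>0: "0 \<le> \<zeta>" and \<eta>0: "0 \<le> \<eta>" using \<zeta>(1)[OF one, of 0] \<eta>(1)[OF one, of 0] by auto
  have cont: "continuous_on {0..1} f" "continuous_on {0..1} fv"
    using f fv by (auto simp: vector_fif_def)
  have A: "\<bar>fst (f x) - fst (fv x)\<bar> \<le> A" and B: "\<bar>snd (f x) - snd (fv x)\<bar> \<le> B" if "x \<in> {0..1}" for x
    unfolding A_def B_def using that
    by (auto intro!: abs_le_sup_norm_I[where g = "\<lambda>x. fst (f x) - fst (fv x)"]
        abs_le_sup_norm_I[where g = "\<lambda>x. snd (f x) - snd (fv x)"] continuous_intros cont)
  \<comment> \<open>The two data sets share the \<open>u i\<close>, so the first increment vanishes;
    it is kept to match the shape of \<open>edelstein_combination_bound\<close>.\<close>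
  have Mend: "c * (\<bar>u i - u i\<bar> + \<bar>v i - v' i\<bar>) \<le> c * M" if "i \<in> {0..N}" "0 \<le> c" for c i
    using M[OF that(1)] that(2) by (simp add: mult_left_mono)
  have p: "\<bar>p j x - pv j x\<bar> \<le> \<zeta> * M + P / 2" and q: "\<bar>q j x - qv j x\<bar> \<le> (1 + \<eta>) * M + Q / 2"
    if j: "j \<in> {1..N}" and x: "x \<in> {0..1}" for j x
  proof -
    have zc: "\<bar>(\<alpha> j y * s j (u i) + \<beta> j y * r j (v i)) - (\<alpha> j y * s j (u i) + \<beta> j y * r j (v' i))\<bar>
        \<le> \<zeta> * M"
      and ec: "\<bar>(\<gamma> j y * s j (u i) + \<delta> j y * r j (v i)) - (\<gamma> j y * s j (u i) + \<delta> j y * r j (v' i))\<bar>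
        \<le> \<eta> * M"
      if "y \<in> {0..1}" "i \<in> {0..N}" for y i
      using edelstein_combination_bound[OF V.edelstein_s[OF j] V.edelstein_r[OF j] \<zeta>[OF j that(1)],
          of "u i" "v i" "u i" "v' i"]
        edelstein_combination_bound[OF V.edelstein_s[OF j] V.edelstein_r[OF j] \<eta>[OF j that(1)],
          of "u i" "v i" "u i" "v' i"] Mend[OF that(2) \<zeta>0] Mend[OF that(2) \<eta>0]
      by linarith+
    \<comment> \<open>The join-up equations determine \<open>p j\<close>, \<open>pv j\<close>,
      \<open>q j\<close>, \<open>qv j\<close> at 0 and 1. In the first component the targets
      \<open>u (j - 1)\<close> and \<open>u j\<close> agree and cancel. In the second they differ by
      at most \<open>M\<close>, whence the factor \<open>1 + \<eta>\<close>.\<close>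
    note ends = V.F_first[OF j] V'.F_first[OF j] V.F_last[OF j] V'.F_last[OF j]
    note ends = ends[unfolded F_map_def V.t_first V.t_last fst_conv snd_conv prod.inject]
    have Mj: "\<bar>v (j - 1) - v' (j - 1)\<bar> \<le> M" "\<bar>v j - v' j\<bar> \<le> M" using j by (auto intro!: M)
    have \<eta>M: "(1 + \<eta>) * M = M + \<eta> * M" by (simp add: algebra_simps)
    have "\<bar>p j x - pv j x\<bar> \<le> \<zeta> * M + (lp j + lpv j) / 2"
      by (rule lipschitz_on_unit_interval_bound[OF lipschitz_on_diff[OF lp[OF j] lpv[OF j]] _ _ x])
        (use zc[of 0 0] zc[of 1 N] ends in auto)
    then show "\<bar>p j x - pv j x\<bar> \<le> \<zeta> * M + P / 2"
      using P[OF j] by (simp add: add_divide_distrib)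
    have "\<bar>q j x - qv j x\<bar> \<le> (1 + \<eta>) * M + (lq j + lqv j) / 2"
      by (rule lipschitz_on_unit_interval_bound[OF lipschitz_on_diff[OF lq[OF j] lqv[OF j]] _ _ x])
        (use ec[of 0 0] ends Mj(1) \<eta>M in force, use ec[of 1 N] ends Mj(2) \<eta>M in force)
    then show "\<bar>q j x - qv j x\<bar> \<le> (1 + \<eta>) * M + Q / 2"
      using Q[OF j] by (simp add: add_divide_distrib)
  qed
  have eqs: "f (L_map N t j x) = F_map \<alpha> \<beta> \<gamma> \<delta> s r p q j x (f x)"
    "fv (L_map N t j x) = F_map \<alpha> \<beta> \<gamma> \<delta> s r pv qv j x (fv x)"
    if "j \<in> {1..N}" "x \<in> {0..1}" for j x
    using f fv that by (auto simp: vector_fif_def)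
  have step: "c * (\<bar>fst (f x) - fst (fv x)\<bar> + \<bar>snd (f x) - snd (fv x)\<bar>) \<le> c * (A + B)"
    if "x \<in> {0..1}" "0 \<le> c" for c x
    using A[OF that(1)] B[OF that(1)] that(2) by (intro mult_left_mono) auto
  have A_le: "A \<le> \<zeta> * (A + B) + (\<zeta> * M + P / 2)"
    unfolding A_def
  proof (rule V.sup_norm_I_le_by_pieces, fold A_def)
    fix j x assume jx: "j \<in> {1..N}" "x \<in> {0..1::real}"
    show "\<bar>fst (f (L_map N t j x)) - fst (fv (L_map N t j x))\<bar> \<le> \<zeta> * (A + B) + (\<zeta> * M + P / 2)"
      using edelstein_combination_bound[OF V.edelstein_s[OF jx(1)] V.edelstein_r[OF jx(1)] \<zeta>[OF jx],
          of "fst (f x)" "snd (f x)" "fst (fv x)" "snd (fv x)"]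
        step[OF jx(2) \<zeta>0] p[OF jx]
      unfolding eqs[OF jx] F_map_def fst_conv by linarith
  qed
  have B_le: "B \<le> \<eta> * (A + B) + ((1 + \<eta>) * M + Q / 2)"
    unfolding B_def
  proof (rule V.sup_norm_I_le_by_pieces, fold B_def)
    fix j x assume jx: "j \<in> {1..N}" "x \<in> {0..1::real}"
    show "\<bar>snd (f (L_map N t j x)) - snd (fv (L_map N t j x))\<bar> \<le> \<eta> * (A + B) + ((1 + \<eta>) * M + Q / 2)"
      using edelstein_combination_bound[OF V.edelstein_s[OF jx(1)] V.edelstein_r[OF jx(1)] \<eta>[OF jx],
          of "fst (f x)" "snd (f x)" "fst (fv x)" "snd (fv x)"]
        step[OF jx(2) \<eta>0] q[OF jx]
      unfolding eqs[OF jx] F_map_def snd_conv by linarith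
  qed
  \<comment> \<open>The multipliers \<open>1 - \<eta>\<close> here and \<open>\<zeta>\<close> for
    the second inequality make the B terms cancel on addition. What remains has coefficient
    \<open>(1 - \<zeta>) * (1 - \<eta>) - \<zeta> * \<eta> = 1 - \<zeta> - \<eta>\<close> at
    \<open>A\<close> and \<open>\<zeta> * (1 - \<eta>) + \<zeta> * (1 + \<eta>) = 2 *
    \<zeta>\<close> at \<open>M\<close>.\<close>
  have "(1 - \<eta>) * ((1 - \<zeta>) * A) \<le> (1 - \<eta>) * (\<zeta> * B + \<zeta> * M + P / 2)"
    using A_le zeta_eta \<zeta>0 by (intro mult_left_mono) (auto simp: algebra_simps)
  moreover have "\<zeta> * ((1 - \<eta>) * B) \<le> \<zeta> * (\<eta> * A + (1 + \<eta>) * M + Q / 2)"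
    using B_le \<zeta>0 by (intro mult_left_mono) (auto simp: algebra_simps)
  ultimately have A_bound: "(1 - \<zeta> - \<eta>) * A \<le> 2 * \<zeta> * M + \<zeta> * Q / 2 + (1 - \<eta>) * P / 2"
    by (simp add: algebra_simps)
  \<comment> \<open>The gap between the claimed bound and \<open>A_bound\<close> is half of the Q
    and P terms plus \<open>(1 - \<zeta>) * (1 - \<eta>) * M\<close>. Each summand is nonnegative,
    and since \<open>\<zeta>\<close> and \<open>\<eta>\<close> are below 1,
    \<open>nondegenerate\<close> makes one of them positive.\<close>
  have "0 \<le> \<zeta> * Q" "0 \<le> (1 - \<eta>) * P" "0 \<le> (1 - \<zeta>) * (1 - \<eta>) * M"
    using \<zeta>0 \<eta>0 zeta_eta M0 P0 Q0 by simp_all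
  moreover have "0 < \<zeta> * Q \<or> 0 < (1 - \<eta>) * P \<or> 0 < (1 - \<zeta>) * (1 - \<eta>) * M"
    using nondegenerate \<zeta>0 \<eta>0 zeta_eta unfolding M_def[symmetric] P_def[symmetric] Q_def[symmetric]
    by auto
  ultimately have "0 < \<zeta> * Q / 2 + (1 - \<eta>) * P / 2 + (1 - \<zeta>) * (1 - \<eta>) * M" by linarith
  moreover have "(1 + \<zeta> - \<eta> + \<zeta> * \<eta>) * M = 2 * \<zeta> * M + (1 - \<zeta>) * (1 - \<eta>) * M"
    by (simp add: algebra_simps)
  ultimately have "(1 - \<zeta> - \<eta>) * A < \<zeta> * Q + (1 + \<zeta> - \<eta> + \<zeta> * \<eta>) * M + (1 - \<eta>) * P"
    using A_bound by linarith
  then have "A < (\<zeta> * Q + (1 + \<zeta> - \<eta> + \<zeta> * \<eta>) * M + (1 - \<eta>) * P) / (1 - \<zeta> - \<eta>)"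
    using zeta_eta by (simp add: pos_less_divide_eq mult.commute)
  then show ?thesis
    unfolding A_def[symmetric] M_def[symmetric] P_def[symmetric] Q_def[symmetric]
    by (simp only: add_divide_distrib[of "_ + _" "(1 - \<eta>) * P"] add_divide_distrib[of "\<zeta> * Q"]
        times_divide_eq_left)
qed

end
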